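(* Let $\Delta$ be a rank 2 hyperbolic root system. Then $\Delta$ contains symmetric rank 2 hyperbolic root subsystems of type $H(k,k)$ for infinitely many distinct $k\ge 3$. If $\Delta$ is non-symmetric of type $H(a,b)$, then it also contains non-symmetric rank 2 hyperbolic root subsystems of type $H(a\ell,b\ell)$ for infinitely many distinct $\ell\ge 2$. Both assertions hold for either concept of subsystem ($\Phi$-subsystem or $\Delta$-subsystem).
   Context: For integers $m,n\ge1$ let $H(m,n)=\begin{pmatrix}2&-n\\-m&2\end{pmatrix}$. For integers $a\ge b\ge 1$ with $ab>4$, the rank 2 hyperbolic root system $\Delta$ of type $H(a,b)$ is the root system of the Kac--Moody algebra with generalized Cartan matrix $H(a,b)$; it is symmetric if $a=b$ and non-symmetric if $a\neq b$. Simple roots are $\alpha_1,\alpha_2$; simple reflections $w_1(\alpha_1)=-\alpha_1$, $w_1(\alpha_2)=\alpha_2+b\alpha_1$, $w_2(\alpha_1)=\alpha_1+a\alpha_2$, $w_2(\alpha_2)=-\alpha_2$; $W=\langle w_1,w_2\rangle$; symmetric bilinear form $(\alpha_1,\alpha_1)=2a/b$, $(\alpha_1,\alpha_2)=-a$, $(\alpha_2,\alpha_2)=2$. Real roots: $\Delta^{\mathrm{re}}=W\alpha_1\cup W\alpha_2$. Imaginary roots: the nonzero $\alpha\in\mathbb Z\alpha_1+\mathbb Z\alpha_2$ with $(\alpha,\alpha)\le0$. $\Delta$ is the union of both. For a real root $\alpha$, $w_\alpha(\beta)=\beta-\frac{2(\beta,\alpha)}{(\alpha,\alpha)}\alpha$.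 For $\Gamma\subseteq\Delta^{\mathrm{re}}$: $W_\Gamma=\langle w_\alpha:\alpha\in\Gamma\rangle$. A $\Phi$-subsystem is a set $\Phi(\Gamma)=W_\Gamma\cdot\Gamma$; a $\Delta$-subsystem is a set $\Delta(\Gamma)=\mathbb Z\Gamma\cap\Delta$, with set of real roots $\Delta^{\mathrm{re}}(\Gamma)=\mathbb Z\Gamma\cap\Delta^{\mathrm{re}}$. A $\Phi$-subsystem $\Psi$ has type $H(m,n)$ if it has a basis of simple roots $\{\beta_1,\beta_2\}\subseteq\Psi$ (so $\Psi=W_{\{\beta_1,\beta_2\}}\cdot\{\beta_1,\beta_2\}$ and every element of $\Psi$ is a nonnegative or a nonpositive integer combination of $\beta_1,\beta_2$) whose Cartan matrix $\left(\frac{2(\beta_i,\beta_j)}{(\beta_i,\beta_i)}\right)_{i,j}$ equals $H(m,n)$. A $\Delta$-subsystem has type $H(m,n)$ if its set of real roots $\Delta^{\mathrm{re}}(\Gamma)$ (which is always a $\Phi$-subsystem) has type $H(m,n)$. *)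

theory Defs
  imports
    "HOL-Analysis.Analysis"
    "HOL-Algebra.Bij"
    "HOL-Algebra.Generated_Groups"
begin

text \<open>Roots live in the real span of the simple roots; the pair \<open>(x, y)\<close> stands for
  \<open>x \<alpha>\<^sub>1 + y \<alpha>\<^sub>2\<close>.\<close>

type_synonym vec = "real \<times> real"

definition \<alpha>\<^sub>1 :: vec where "\<alpha>\<^sub>1 = (1, 0)"
definition \<alpha>\<^sub>2 :: vec where "\<alpha>\<^sub>2 = (0, 1)"

definition H :: "int \<Rightarrow> int \<Rightarrow> real^2^2" where
  "H m n = vector [vector [2, - of_int n], vector [- of_int m, 2]]"

definition form :: "int \<Rightarrow> int \<Rightarrow> vec \<Rightarrow> vec \<Rightarrow> real" where
  "form a b u v =
     2 * of_int a / of_int b * (fst u * fst v)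
     - of_int a * (fst u * snd v + snd u * fst v)
     + 2 * (snd u * snd v)"

definition reflection :: "int \<Rightarrow> int \<Rightarrow> vec \<Rightarrow> vec \<Rightarrow> vec" where
  "reflection a b \<alpha> \<beta> = \<beta> - (2 * form a b \<beta> \<alpha> / form a b \<alpha> \<alpha>) *\<^sub>R \<alpha>"

text \<open>The simple reflections are the linear extensions of
  \<open>\<alpha>\<^sub>1 \<mapsto> - \<alpha>\<^sub>1, \<alpha>\<^sub>2 \<mapsto> \<alpha>\<^sub>2 + b \<alpha>\<^sub>1\<close> and \<open>\<alpha>\<^sub>1 \<mapsto> \<alpha>\<^sub>1 + a \<alpha>\<^sub>2, \<alpha>\<^sub>2 \<mapsto> - \<alpha>\<^sub>2\<close>.\<close>

definition w\<^sub>1 :: "int \<Rightarrow> vec \<Rightarrow> vec" where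
  "w\<^sub>1 b v = fst v *\<^sub>R (- \<alpha>\<^sub>1) + snd v *\<^sub>R (\<alpha>\<^sub>2 + of_int b *\<^sub>R \<alpha>\<^sub>1)"

definition w\<^sub>2 :: "int \<Rightarrow> vec \<Rightarrow> vec" where
  "w\<^sub>2 a v = fst v *\<^sub>R (\<alpha>\<^sub>1 + of_int a *\<^sub>R \<alpha>\<^sub>2) + snd v *\<^sub>R (- \<alpha>\<^sub>2)"

lemma simple_reflections:
  assumes "a \<noteq> 0" "b \<noteq> 0"
  shows "reflection a b \<alpha>\<^sub>1 = w\<^sub>1 b" "reflection a b \<alpha>\<^sub>2 = w\<^sub>2 a"
  using assms
  by (auto simp: fun_eq_iff reflection_def form_def w\<^sub>1_def w\<^sub>2_def \<alpha>\<^sub>1_def \<alpha>\<^sub>2_def field_simps)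

definition weyl_group :: "int \<Rightarrow> int \<Rightarrow> (vec \<Rightarrow> vec) set" where
  "weyl_group a b = generate (BijGroup UNIV) {w\<^sub>1 b, w\<^sub>2 a}"

definition int_span :: "vec set \<Rightarrow> vec set" where
  "int_span S = {\<Sum>v\<in>F. of_int (c v) *\<^sub>R v | F (c :: vec \<Rightarrow> int). finite F \<and> F \<subseteq> S}"

definition real_roots :: "int \<Rightarrow> int \<Rightarrow> vec set" where
  "real_roots a b = {g \<alpha>\<^sub>1 | g. g \<in> weyl_group a b} \<union> {g \<alpha>\<^sub>2 | g. g \<in> weyl_group a b}"

definition imag_roots :: "int \<Rightarrow> int \<Rightarrow> vec set" where
  "imag_roots a b = {\<alpha> \<in> int_span {\<alpha>\<^sub>1, \<alpha>\<^sub>2}. \<alpha> \<noteq> 0 \<and> form a b \<alpha> \<alpha> \<le> 0}"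

definition roots :: "int \<Rightarrow> int \<Rightarrow> vec set" where
  "roots a b = real_roots a b \<union> imag_roots a b"

definition reflection_group :: "int \<Rightarrow> int \<Rightarrow> vec set \<Rightarrow> (vec \<Rightarrow> vec) set" where
  "reflection_group a b \<Gamma> = generate (BijGroup UNIV) (reflection a b ` \<Gamma>)"

definition \<Phi> :: "int \<Rightarrow> int \<Rightarrow> vec set \<Rightarrow> vec set" where
  "\<Phi> a b \<Gamma> = {g \<gamma> | g \<gamma>. g \<in> reflection_group a b \<Gamma> \<and> \<gamma> \<in> \<Gamma>}"

definition \<Delta> :: "int \<Rightarrow> int \<Rightarrow> vec set \<Rightarrow> vec set" where
  "\<Delta> a b \<Gamma> = int_span \<Gamma> \<inter> roots a b"

definition \<Delta>re :: "int \<Rightarrow> int \<Rightarrow> vec set \<Rightarrow> vec set" where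
  "\<Delta>re a b \<Gamma> = int_span \<Gamma> \<inter> real_roots a b"

definition \<Phi>_subsystem :: "int \<Rightarrow> int \<Rightarrow> vec set \<Rightarrow> bool" where
  "\<Phi>_subsystem a b \<Psi> \<longleftrightarrow> (\<exists>\<Gamma> \<subseteq> real_roots a b. \<Psi> = \<Phi> a b \<Gamma>)"

definition cartan_matrix :: "int \<Rightarrow> int \<Rightarrow> vec \<Rightarrow> vec \<Rightarrow> real^2^2" where
  "cartan_matrix a b \<beta>\<^sub>1 \<beta>\<^sub>2 =
     (let c = (\<lambda>\<beta> \<beta>'. 2 * form a b \<beta> \<beta>' / form a b \<beta> \<beta>)
      in vector [vector [c \<beta>\<^sub>1 \<beta>\<^sub>1, c \<beta>\<^sub>1 \<beta>\<^sub>2], vector [c \<beta>\<^sub>2 \<beta>\<^sub>1, c \<beta>\<^sub>2 \<beta>\<^sub>2]])"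

definition simple_basis :: "int \<Rightarrow> int \<Rightarrow> vec set \<Rightarrow> vec \<Rightarrow> vec \<Rightarrow> bool" where
  "simple_basis a b \<Psi> \<beta>\<^sub>1 \<beta>\<^sub>2 \<longleftrightarrow>
     {\<beta>\<^sub>1, \<beta>\<^sub>2} \<subseteq> \<Psi> \<and> \<beta>\<^sub>1 \<noteq> \<beta>\<^sub>2 \<and> independent {\<beta>\<^sub>1, \<beta>\<^sub>2} \<and>
     \<Psi> = \<Phi> a b {\<beta>\<^sub>1, \<beta>\<^sub>2} \<and>
     (\<forall>\<gamma>\<in>\<Psi>. \<exists>p q :: nat.
        \<gamma> = of_nat p *\<^sub>R \<beta>\<^sub>1 + of_nat q *\<^sub>R \<beta>\<^sub>2 \<or>
        \<gamma> = - (of_nat p *\<^sub>R \<beta>\<^sub>1 + of_nat q *\<^sub>R \<beta>\<^sub>2))"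

definition \<Phi>_subsystem_of_type :: "int \<Rightarrow> int \<Rightarrow> vec set \<Rightarrow> int \<Rightarrow> int \<Rightarrow> bool" where
  "\<Phi>_subsystem_of_type a b \<Psi> m n \<longleftrightarrow>
     \<Phi>_subsystem a b \<Psi> \<and>
     (\<exists>\<beta>\<^sub>1 \<beta>\<^sub>2. simple_basis a b \<Psi> \<beta>\<^sub>1 \<beta>\<^sub>2 \<and> cartan_matrix a b \<beta>\<^sub>1 \<beta>\<^sub>2 = H m n)"

definition \<Delta>_subsystem_of_type :: "int \<Rightarrow> int \<Rightarrow> vec set \<Rightarrow> int \<Rightarrow> int \<Rightarrow> bool" where
  "\<Delta>_subsystem_of_type a b D m n \<longleftrightarrow>
     (\<exists>\<Gamma> \<subseteq> real_roots a b. D = \<Delta> a b \<Gamma> \<and> \<Phi>_subsystem_of_type a b (\<Delta>re a b \<Gamma>) m n)"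

end

theory Submission
  imports Defs
begin

text \<open>The subsystems are generated by pairs \<open>\<beta>\<^sub>1, \<beta>\<^sub>2\<close> of real roots, where \<open>\<beta>\<^sub>1\<close> is long and
  \<open>(\<beta>\<^sub>1, \<beta>\<^sub>2) < 0\<close>. The proof compares norms.

  Every real root has a norm between \<open>0\<close> (exclusive) and that of a long root. A combination
  \<open>p \<beta>\<^sub>1 + q \<beta>\<^sub>2\<close> whose integer coefficients have opposite signs is longer than \<open>\<beta>\<^sub>1\<close>, so it is never
  a real root (\<open>real_root_sign_coherent\<close>). Thus every real root in the lattice \<open>\<int>\<beta>\<^sub>1 + \<int>\<beta>\<^sub>2\<close>
  is a nonnegative or a nonpositive combination of \<open>\<beta>\<^sub>1\<close> and \<open>\<beta>\<^sub>2\<close>.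

  If both coefficients of such a root are nonzero, positivity of its norm forces one of the two
  reflections \<open>w\<^bsub>\<beta>\<^sub>1\<^esub>\<close>, \<open>w\<^bsub>\<beta>\<^sub>2\<^esub>\<close> to make a coefficient smaller in absolute value. The descent ends at
  a multiple of \<open>\<beta>\<^sub>1\<close> or \<open>\<beta>\<^sub>2\<close>, and as real roots are primitive in the root lattice, at
  \<open>\<plusminus> \<beta>\<^sub>1\<close> or \<open>\<plusminus> \<beta>\<^sub>2\<close> (\<open>comb_in_\<Phi>\<close>). Hence the real roots of the lattice are exactly the
  \<open>\<Phi>\<close>-subsystem generated by the pair, and the two notions of subsystem are
  served by the same pairs.

  It remains to find infinitely many Cartan matrices. With \<open>\<beta>\<^sub>1 = \<alpha>\<^sub>1\<close> and \<open>\<gamma>\<close> a long root giving type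
  \<open>H(k, k)\<close>, the long root \<open>w\<^sub>\<gamma> \<alpha>\<^sub>1\<close> gives \<open>k\<^sup>2 - 2\<close> instead of \<open>k\<close>; the start is
  \<open>\<gamma> = w\<^sub>2 \<alpha>\<^sub>1\<close>, with \<open>k = a b - 2 \<ge> 3\<close>. With \<open>\<gamma>\<close> a root of norm \<open>2\<close> giving type
  \<open>H(a l, b l)\<close>, the root \<open>w\<^sub>\<gamma> w\<^sub>1 \<gamma>\<close> gives \<open>l (a b l\<^sup>2 - 3)\<close>; the start is \<open>\<gamma> = \<alpha>\<^sub>2\<close>, with
  \<open>l = 1\<close>.\<close>

section \<open>Reflections, groups generated by involutions, and lattices\<close>

lemma form_add_left: "form a b (u + v) x = form a b u x + form a b v x"
  and form_diff_left: "form a b (u - v) x = form a b u x - form a b v x"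
  and form_scaleR_left: "form a b (r *\<^sub>R u) x = r * form a b u x"
  and form_uminus_left: "form a b (- u) x = - form a b u x"
  by (simp_all add: form_def algebra_simps add_divide_distrib diff_divide_distrib)

lemma form_commute: "form a b u v = form a b v u"
  by (simp add: form_def algebra_simps)

lemma form_add_right: "form a b x (u + v) = form a b x u + form a b x v"
  and form_diff_right: "form a b x (u - v) = form a b x u - form a b x v"
  and form_scaleR_right: "form a b x (r *\<^sub>R u) = r * form a b x u"
  and form_uminus_right: "form a b x (- u) = - form a b x u"
  by (simp_all add: form_commute[of a b x] form_add_left form_diff_left form_scaleR_left
      form_uminus_left)

lemmas form_bilinear = form_add_left form_diff_left form_scaleR_left form_uminus_left
  form_add_right form_diff_right form_scaleR_right form_uminus_right

lemma linear_reflection: "linear (reflection a b \<gamma>)"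
  by (rule linearI)
    (simp_all add: reflection_def form_bilinear algebra_simps add_divide_distrib)

lemma reflection_self: "form a b \<gamma> \<gamma> \<noteq> 0 \<Longrightarrow> reflection a b \<gamma> \<gamma> = - \<gamma>"
  by (simp add: reflection_def scaleR_2)

lemma reflection_involution:
  "form a b \<gamma> \<gamma> \<noteq> 0 \<Longrightarrow> reflection a b \<gamma> (reflection a b \<gamma> x) = x"
  by (simp add: reflection_def form_bilinear algebra_simps flip: scaleR_add_left)

lemma form_reflection:
  assumes "form a b \<gamma> \<gamma> \<noteq> 0"
  shows "form a b (reflection a b \<gamma> x) (reflection a b \<gamma> y) = form a b x y"
proof -
  define c where "c z = 2 * form a b z \<gamma> / form a b \<gamma> \<gamma>" for z
  have c: "form a b z \<gamma> = c z * form a b \<gamma> \<gamma> / 2" for z using assms by (simp add: c_def)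
  have "form a b (x - c x *\<^sub>R \<gamma>) (y - c y *\<^sub>R \<gamma>) = form a b x y"
    by (simp add: form_bilinear form_commute[of a b \<gamma> y] c[of x] c[of y])
  then show ?thesis by (simp only: reflection_def c_def)
qed

lemma involutions_in_Bij:
  assumes "\<forall>s\<in>S. \<forall>x. s (s x) = x"
  shows "S \<subseteq> carrier (BijGroup UNIV)"
proof
  fix s assume "s \<in> S"
  then have "bij s" using assms by (intro involuntory_imp_bij) auto
  then show "s \<in> carrier (BijGroup UNIV)" by (simp add: BijGroup_def Bij_def extensional_def)
qed

lemma mult_BijGroup_UNIV:
  "g \<in> carrier (BijGroup UNIV) \<Longrightarrow> h \<in> carrier (BijGroup UNIV) \<Longrightarrow>
   g \<otimes>\<^bsub>BijGroup UNIV\<^esub> h = g \<circ> h"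
  by (auto simp: BijGroup_def compose_def)

lemma one_BijGroup_UNIV: "\<one>\<^bsub>BijGroup UNIV\<^esub> = id"
  by (auto simp: BijGroup_def)

lemma generate_involutions_comp:
  assumes "\<forall>s\<in>S. \<forall>x. s (s x) = x"
    and "g \<in> generate (BijGroup UNIV) S" "h \<in> generate (BijGroup UNIV) S"
  shows "g \<circ> h \<in> generate (BijGroup UNIV) S"
proof -
  interpret group "BijGroup UNIV" by (rule group_BijGroup)
  have "S \<subseteq> carrier (BijGroup UNIV)" using assms(1) by (rule involutions_in_Bij)
  then show ?thesis
    using assms(2,3) generate.eng[OF assms(2,3)] generate_in_carrier mult_BijGroup_UNIV by metis
qed

text \<open>A generator that is an involution is its own inverse, so induction over the generated group
  never has to consider inverses.\<close>

lemma generate_involutions_induct [consumes 2, case_names id gen comp]: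
  assumes g: "g \<in> generate (BijGroup UNIV) S"
    and inv: "\<forall>s\<in>S. \<forall>x. s (s x) = x"
    and id: "P id"
    and gen: "\<And>s. s \<in> S \<Longrightarrow> P s"
    and comp: "\<And>g h. g \<in> generate (BijGroup UNIV) S \<Longrightarrow> h \<in> generate (BijGroup UNIV) S \<Longrightarrow>
      P g \<Longrightarrow> P h \<Longrightarrow> P (g \<circ> h)"
  shows "P g"
proof -
  interpret group "BijGroup UNIV" by (rule group_BijGroup)
  have S: "S \<subseteq> carrier (BijGroup UNIV)" using inv by (rule involutions_in_Bij)
  from g show ?thesis
  proof (induction rule: generate.induct)
    case one
    then show ?case using id by (simp only: one_BijGroup_UNIV)
  next
    case (incl s)
    then show ?case by (rule gen)
  next
    case (inv s)
    have "s \<otimes>\<^bsub>BijGroup UNIV\<^esub> s = \<one>\<^bsub>BijGroup UNIV\<^esub>"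
      using inv S assms(2) by (auto simp: mult_BijGroup_UNIV one_BijGroup_UNIV subset_iff)
    then have "inv\<^bsub>BijGroup UNIV\<^esub> s = s"
      using inv S inv_equality by blast
    then show ?case using gen inv by simp
  next
    case (eng h1 h2)
    then have "h1 \<otimes>\<^bsub>BijGroup UNIV\<^esub> h2 = h1 \<circ> h2"
      using generate_in_carrier[OF S] mult_BijGroup_UNIV by blast
    then show ?case using comp[OF eng.hyps eng.IH] by (simp only:)
  qed
qed

lemma generate_involutions_inverse:
  assumes "g \<in> generate (BijGroup UNIV) S" and inv: "\<forall>s\<in>S. \<forall>x. s (s x) = x"
  obtains h where "h \<in> generate (BijGroup UNIV) S" "\<And>x. g (h x) = x" "\<And>x. h (g x) = x"
proof -
  have "\<exists>h \<in> generate (BijGroup UNIV) S. (\<forall>x. g (h x) = x) \<and> (\<forall>x. h (g x) = x)"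
    using assms
  proof (induction rule: generate_involutions_induct)
    case id
    have "id \<in> generate (BijGroup UNIV) S"
      using generate.one[of "BijGroup UNIV" S] by (simp only: one_BijGroup_UNIV)
    then show ?case by (intro bexI[of _ id] conjI allI) (simp_all only: id_apply)
  next
    case (gen s)
    then show ?case using inv generate.incl[OF gen] by (intro bexI[of _ s] conjI) auto
  next
    case (comp g h)
    from comp(3) obtain g' where g': "g' \<in> generate (BijGroup UNIV) S"
      "\<forall>x. g (g' x) = x" "\<forall>x. g' (g x) = x" by (elim bexE conjE)
    from comp(4) obtain h' where h': "h' \<in> generate (BijGroup UNIV) S"
      "\<forall>x. h (h' x) = x" "\<forall>x. h' (h x) = x" by (elim bexE conjE)
    have "h' \<circ> g' \<in> generate (BijGroup UNIV) S"
      using inv h'(1) g'(1) by (rule generate_involutions_comp)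
    then show ?case using g'(2,3) h'(2,3) by (intro bexI[of _ "h' \<circ> g'"] conjI allI) simp_all
  qed
  then show ?thesis using that by blast
qed

lemma int_span_pair:
  "int_span {u, v} = {of_int p *\<^sub>R u + of_int q *\<^sub>R v | p q. True}"
proof (intro equalityI subsetI)
  fix x assume "x \<in> int_span {u, v}"
  then obtain F and c :: "vec \<Rightarrow> int"
    where F: "F \<subseteq> {u, v}" and x: "x = (\<Sum>v\<in>F. of_int (c v) *\<^sub>R v)"
    by (auto simp: int_span_def)
  from F consider "F = {}" | "F = {u}" | "F = {v}" | "F = {u, v}" "u \<noteq> v" by auto
  then have "\<exists>p q. x = of_int p *\<^sub>R u + of_int q *\<^sub>R v"
  proof cases
    case 1 then show ?thesis using x by (intro exI[of _ 0]) simp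
  next
    case 2 then show ?thesis using x by (intro exI[of _ "c u"] exI[of _ 0]) simp
  next
    case 3 then show ?thesis using x by (intro exI[of _ 0] exI[of _ "c v"]) simp
  next
    case 4 then show ?thesis using x by (intro exI[of _ "c u"] exI[of _ "c v"]) simp
  qed
  then show "x \<in> {of_int p *\<^sub>R u + of_int q *\<^sub>R v | p q. True}" by auto
next
  fix x assume "x \<in> {of_int p *\<^sub>R u + of_int q *\<^sub>R v | p q. True}"
  then obtain p q :: int where x: "x = of_int p *\<^sub>R u + of_int q *\<^sub>R v" by auto
  show "x \<in> int_span {u, v}"
  proof (cases "u = v")
    case True
    then show ?thesis using x unfolding int_span_def
      by (intro CollectI exI[of _ "{u}"] exI[of _ "\<lambda>_. p + q"]) (simp add: scaleR_add_left)
  next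
    case False
    then show ?thesis using x unfolding int_span_def
      by (intro CollectI exI[of _ "{u, v}"] exI[of _ "\<lambda>w. if w = u then p else q"]) simp
  qed
qed

section \<open>Real roots\<close>

locale rank2_hyperbolic =
  fixes a b :: int
  assumes b_ge_1: "b \<ge> 1" and b_le_a: "b \<le> a" and ab_gt_4: "a * b > 4"
begin

abbreviation R :: "vec set" where "R \<equiv> real_roots a b"
abbreviation W :: "(vec \<Rightarrow> vec) set" where "W \<equiv> weyl_group a b"
abbreviation refl :: "vec \<Rightarrow> vec \<Rightarrow> vec" where "refl \<equiv> reflection a b"
abbreviation ip :: "vec \<Rightarrow> vec \<Rightarrow> real" where "ip \<equiv> form a b"
abbreviation long_norm :: real where "long_norm \<equiv> 2 * of_int a / of_int b"

lemma a_pos: "a > 0" using b_ge_1 b_le_a by simp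

lemma long_ge_2: "2 \<le> long_norm"
  using b_ge_1 b_le_a by (simp add: field_simps)

lemma ip_simple: "ip \<alpha>\<^sub>1 \<alpha>\<^sub>1 = long_norm" "ip \<alpha>\<^sub>1 \<alpha>\<^sub>2 = - of_int a" "ip \<alpha>\<^sub>2 \<alpha>\<^sub>2 = 2"
  by (simp_all add: form_def \<alpha>\<^sub>1_def \<alpha>\<^sub>2_def)

lemma simple_roots_nonisotropic: "ip \<alpha>\<^sub>1 \<alpha>\<^sub>1 \<noteq> 0" "ip \<alpha>\<^sub>2 \<alpha>\<^sub>2 \<noteq> 0"
  using long_ge_2 unfolding ip_simple by linarith+

lemma weyl_group_eq: "W = generate (BijGroup UNIV) {refl \<alpha>\<^sub>1, refl \<alpha>\<^sub>2}"
  using b_ge_1 a_pos by (simp add: weyl_group_def simple_reflections)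

lemma simple_involution: "\<forall>s\<in>{refl \<alpha>\<^sub>1, refl \<alpha>\<^sub>2}. \<forall>x. s (s x) = x"
  by (simp add: simple_roots_nonisotropic reflection_involution)

lemmas weyl_comp = generate_involutions_comp
  [where S = "{refl \<alpha>\<^sub>1, refl \<alpha>\<^sub>2}", OF simple_involution, folded weyl_group_eq]

lemmas weyl_induct [consumes 1, case_names id gen comp] = generate_involutions_induct
  [where S = "{refl \<alpha>\<^sub>1, refl \<alpha>\<^sub>2}", OF _ simple_involution, folded weyl_group_eq]

lemma weyl_inverse:
  assumes "g \<in> W"
  obtains h where "h \<in> W" "\<And>x. g (h x) = x" "\<And>x. h (g x) = x"
  using generate_involutions_inverse[OF assms[unfolded weyl_group_eq] simple_involution] that
  unfolding weyl_group_eq .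

lemma simple_reflections_in_weyl: "refl \<alpha>\<^sub>1 \<in> W" "refl \<alpha>\<^sub>2 \<in> W"
  by (auto simp: weyl_group_eq intro: generate.incl)

lemma id_in_weyl: "id \<in> W"
  unfolding weyl_group_eq one_BijGroup_UNIV[symmetric] by (rule generate.one)

lemma weyl_linear: "g \<in> W \<Longrightarrow> linear g"
proof (induction rule: weyl_induct)
  case id show ?case unfolding id_def by (rule linear_ident)
next
  case (gen s) then show ?case by (auto intro: linear_reflection)
next
  case (comp g h) show ?case by (rule linear_compose[OF comp(4,3)])
qed

lemma weyl_isometry: "g \<in> W \<Longrightarrow> ip (g x) (g y) = ip x y"
proof (induction arbitrary: x y rule: weyl_induct)
  case (gen s)
  then show ?case
    by (auto simp: form_reflection[OF simple_roots_nonisotropic(1)]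
        form_reflection[OF simple_roots_nonisotropic(2)])
next
  case (comp g h) then show ?case by (simp only: o_apply)
qed (simp only: id_apply)

lemma real_roots_eq: "R = {g \<alpha> | g \<alpha>. g \<in> W \<and> \<alpha> \<in> {\<alpha>\<^sub>1, \<alpha>\<^sub>2}}"
  unfolding real_roots_def by blast

lemma real_rootI: "g \<in> W \<Longrightarrow> \<alpha> \<in> {\<alpha>\<^sub>1, \<alpha>\<^sub>2} \<Longrightarrow> g \<alpha> \<in> R"
  unfolding real_roots_eq by (rule CollectI, intro exI conjI, rule HOL.refl)

lemma real_rootE:
  assumes "\<gamma> \<in> R"
  obtains g \<alpha> where "g \<in> W" "\<alpha> \<in> {\<alpha>\<^sub>1, \<alpha>\<^sub>2}" "\<gamma> = g \<alpha>"
  using assms unfolding real_roots_eq by (elim CollectE exE conjE)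

lemma simple_roots_real: "\<alpha>\<^sub>1 \<in> R" "\<alpha>\<^sub>2 \<in> R"
  using real_rootI[OF id_in_weyl, of \<alpha>\<^sub>1] real_rootI[OF id_in_weyl, of \<alpha>\<^sub>2] by simp_all

lemma weyl_real_root:
  assumes g: "g \<in> W" and \<gamma>: "\<gamma> \<in> R"
  shows "g \<gamma> \<in> R"
proof -
  obtain h \<alpha> where h: "h \<in> W" "\<alpha> \<in> {\<alpha>\<^sub>1, \<alpha>\<^sub>2}" "\<gamma> = h \<alpha>"
    using \<gamma> by (rule real_rootE)
  then show ?thesis using real_rootI[OF weyl_comp[OF g h(1)] h(2)] by simp
qed

lemma real_root_norm:
  assumes "\<gamma> \<in> R"
  shows "0 < ip \<gamma> \<gamma>" and "ip \<gamma> \<gamma> \<le> long_norm"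
  using assms long_ge_2 by (auto elim!: real_rootE simp: weyl_isometry ip_simple)

text \<open>Conjugating a simple reflection by \<open>g\<close> gives the reflection in the image root; hence every
  reflection in a real root lies in the Weyl group.\<close>

lemma real_root_reflection_in_weyl:
  assumes "\<gamma> \<in> R"
  shows "refl \<gamma> \<in> W"
proof -
  obtain g \<alpha> where g: "g \<in> W" and \<alpha>: "\<alpha> \<in> {\<alpha>\<^sub>1, \<alpha>\<^sub>2}" and \<gamma>: "\<gamma> = g \<alpha>"
    using assms by (rule real_rootE)
  obtain h where h: "h \<in> W" "\<And>x. g (h x) = x" "\<And>x. h (g x) = x"
    using g by (rule weyl_inverse) blast
  have "refl \<gamma> x = g (refl \<alpha> (h x))" for x
  proof -
    have "ip x (g \<alpha>) = ip (h x) \<alpha>" using weyl_isometry[OF g, of "h x" \<alpha>] h by simp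
    then show ?thesis
      using weyl_linear[OF g] h
      by (simp add: reflection_def \<gamma> weyl_isometry[OF g] linear_diff linear_scale)
  qed
  then have "refl \<gamma> = g \<circ> (refl \<alpha> \<circ> h)" by auto
  then show ?thesis using \<alpha> weyl_comp[OF g weyl_comp[OF _ h(1)]] simple_reflections_in_weyl by auto
qed

lemma reflection_real_root: "\<gamma> \<in> R \<Longrightarrow> \<delta> \<in> R \<Longrightarrow> refl \<gamma> \<delta> \<in> R"
  by (rule weyl_real_root[OF real_root_reflection_in_weyl])

text \<open>Primitivity of a lattice vector is phrased as a Bezout identity because this form is visibly
  stable under the unimodular substitutions given by the simple reflections.\<close>

lemma real_root_primitive:
  assumes "\<gamma> \<in> R"
  obtains x y s t :: int where "\<gamma> = (of_int x, of_int y)" "s * x + t * y = 1"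
proof -
  define P where "P v \<longleftrightarrow> (\<exists>x y s t :: int. v = (of_int x, of_int y) \<and> s * x + t * y = 1)"
    for v :: vec
  have step: "P (g v)" if "g \<in> W" "P v" for g v
    using that
  proof (induction arbitrary: v rule: weyl_induct)
    case (gen r)
    then obtain x y s t :: int where v: "v = (of_int x, of_int y)" and st: "s * x + t * y = 1"
      by (auto simp: P_def)
    have nz: "a \<noteq> 0" "b \<noteq> 0" using b_ge_1 a_pos by auto
    have refls: "refl \<alpha>\<^sub>1 v = (of_int (b * y - x), of_int y)"
      "refl \<alpha>\<^sub>2 v = (of_int x, of_int (a * x - y))"
      unfolding simple_reflections[OF nz] v
      by (simp_all add: w\<^sub>1_def w\<^sub>2_def \<alpha>\<^sub>1_def \<alpha>\<^sub>2_def algebra_simps)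
    have "(- s) * (b * y - x) + (t + b * s) * y = 1"
      "(s + a * t) * x + (- t) * (a * x - y) = 1"
      using st by (simp_all add: algebra_simps)
    then show ?case using gen(1) refls unfolding P_def by blast
  qed simp_all
  have "P \<alpha>\<^sub>1" unfolding P_def \<alpha>\<^sub>1_def
    by (rule exI[of _ 1], rule exI[of _ 0], rule exI[of _ 1], rule exI[of _ 0]) simp
  moreover have "P \<alpha>\<^sub>2" unfolding P_def \<alpha>\<^sub>2_def
    by (rule exI[of _ 0], rule exI[of _ 1], rule exI[of _ 0], rule exI[of _ 1]) simp
  moreover obtain g \<alpha> where "g \<in> W" "\<alpha> \<in> {\<alpha>\<^sub>1, \<alpha>\<^sub>2}" "\<gamma> = g \<alpha>"
    using assms by (rule real_rootE)
  ultimately have "P \<gamma>" using step[of g \<alpha>] by blast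
  then show ?thesis using that unfolding P_def by (elim exE conjE)
qed

text \<open>Excludes that a long root is a proper multiple of a short one, which norms alone permit when
  \<open>a / b\<close> is a perfect square.\<close>

lemma real_root_multiple:
  assumes "\<gamma> \<in> R" "\<delta> \<in> R" and "\<gamma> = of_int p *\<^sub>R \<delta>"
  shows "p = 1 \<or> p = - 1"
proof -
  obtain x y s t :: int where \<gamma>: "\<gamma> = (of_int x, of_int y)" "s * x + t * y = 1"
    by (rule real_root_primitive[OF assms(1)])
  obtain x' y' :: int where "\<delta> = (of_int x', of_int y')"
    by (rule real_root_primitive[OF assms(2)])
  then have "real_of_int x = of_int (p * x')" "real_of_int y = of_int (p * y')"
    using \<gamma> assms(3) by simp_all
  then have "x = p * x'" "y = p * y'" by (simp_all only: of_int_eq_iff)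
  then have "p * (s * x' + t * y') = 1" using \<gamma>(2) by (simp add: algebra_simps)
  then show ?thesis by (rule pos_zmult_eq_1_iff_lemma)
qed

end

section \<open>Subsystems spanned by a long root and another real root\<close>

locale real_root_pair = rank2_hyperbolic +
  fixes \<beta>\<^sub>1 \<beta>\<^sub>2 :: vec and m n :: int
  assumes real: "\<beta>\<^sub>1 \<in> R" "\<beta>\<^sub>2 \<in> R"
    and long: "ip \<beta>\<^sub>1 \<beta>\<^sub>1 = long_norm"
    and cartan: "2 * ip \<beta>\<^sub>1 \<beta>\<^sub>2 = - of_int n * ip \<beta>\<^sub>1 \<beta>\<^sub>1" "2 * ip \<beta>\<^sub>1 \<beta>\<^sub>2 = - of_int m * ip \<beta>\<^sub>2 \<beta>\<^sub>2"
    and pos: "n > 0" "m > 0" "m * n > 4"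
begin

abbreviation comb :: "int \<Rightarrow> int \<Rightarrow> vec" where
  "comb p q \<equiv> of_int p *\<^sub>R \<beta>\<^sub>1 + of_int q *\<^sub>R \<beta>\<^sub>2"

lemma norm_pos: "ip \<beta>\<^sub>1 \<beta>\<^sub>1 > 0" "ip \<beta>\<^sub>2 \<beta>\<^sub>2 > 0"
  using real real_root_norm by auto

lemma reflection_comb:
  "refl \<beta>\<^sub>1 (comb p q) = comb (n * q - p) q"
  "refl \<beta>\<^sub>2 (comb p q) = comb p (m * p - q)"
proof -
  have "2 * ip (comb p q) \<beta>\<^sub>1 = of_int (2 * p) * ip \<beta>\<^sub>1 \<beta>\<^sub>1 + of_int q * (2 * ip \<beta>\<^sub>1 \<beta>\<^sub>2)"
    by (simp add: form_bilinear form_commute[of a b \<beta>\<^sub>2 \<beta>\<^sub>1])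
  also have "\<dots> = of_int (2 * p - n * q) * ip \<beta>\<^sub>1 \<beta>\<^sub>1"
    unfolding cartan(1) by (simp add: algebra_simps)
  finally have coeff1: "2 * ip (comb p q) \<beta>\<^sub>1 / ip \<beta>\<^sub>1 \<beta>\<^sub>1 = of_int (2 * p - n * q)"
    using norm_pos(1) by simp
  show "refl \<beta>\<^sub>1 (comb p q) = comb (n * q - p) q"
    unfolding reflection_def coeff1 by (simp add: prod_eq_iff algebra_simps)
  have "2 * ip (comb p q) \<beta>\<^sub>2 = of_int (2 * q) * ip \<beta>\<^sub>2 \<beta>\<^sub>2 + of_int p * (2 * ip \<beta>\<^sub>1 \<beta>\<^sub>2)"
    by (simp add: form_bilinear)
  also have "\<dots> = of_int (2 * q - m * p) * ip \<beta>\<^sub>2 \<beta>\<^sub>2"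
    unfolding cartan(2) by (simp add: algebra_simps)
  finally have coeff2: "2 * ip (comb p q) \<beta>\<^sub>2 / ip \<beta>\<^sub>2 \<beta>\<^sub>2 = of_int (2 * q - m * p)"
    using norm_pos(2) by simp
  show "refl \<beta>\<^sub>2 (comb p q) = comb p (m * p - q)"
    unfolding reflection_def coeff2 by (simp add: prod_eq_iff algebra_simps)
qed

lemma norm_comb:
  "ip (comb p q) (comb p q) =
     of_int (p\<^sup>2) * ip \<beta>\<^sub>1 \<beta>\<^sub>1 + of_int (q\<^sup>2) * ip \<beta>\<^sub>2 \<beta>\<^sub>2 + of_int (p * q) * (2 * ip \<beta>\<^sub>1 \<beta>\<^sub>2)"
  by (simp add: form_bilinear form_commute[of a b \<beta>\<^sub>2 \<beta>\<^sub>1] algebra_simps power2_eq_square)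

text \<open>Since \<open>(\<beta>\<^sub>1, \<beta>\<^sub>2) < 0\<close>, coefficients of opposite signs make all three terms of the norm
  positive, and the norm exceeds that of the long root \<open>\<beta>\<^sub>1\<close>.\<close>

lemma real_root_sign_coherent:
  assumes "comb p q \<in> R"
  shows "p * q \<ge> 0"
proof (rule ccontr)
  assume "\<not> p * q \<ge> 0"
  then have pq: "p * q < 0" by simp
  then have "p\<^sup>2 > 0" by auto
  then have "1 \<le> p\<^sup>2" by linarith
  then have "ip \<beta>\<^sub>1 \<beta>\<^sub>1 \<le> of_int (p\<^sup>2) * ip \<beta>\<^sub>1 \<beta>\<^sub>1"
    using norm_pos by (simp del: of_int_power)
  moreover have "0 \<le> of_int (q\<^sup>2) * ip \<beta>\<^sub>2 \<beta>\<^sub>2" using norm_pos by simp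
  moreover have "2 * ip \<beta>\<^sub>1 \<beta>\<^sub>2 < 0" using norm_pos cartan(1) pos by simp
  then have "0 < of_int (p * q) * (2 * ip \<beta>\<^sub>1 \<beta>\<^sub>2)"
    using pq by (intro mult_neg_neg) (simp_all only: of_int_less_0_iff)
  ultimately have "ip (comb p q) (comb p q) > long_norm" unfolding norm_comb long by linarith
  then show False using real_root_norm(2)[OF assms] by linarith
qed

lemma pair_involution: "\<forall>s\<in>refl ` {\<beta>\<^sub>1, \<beta>\<^sub>2}. \<forall>x. s (s x) = x"
  using norm_pos by (auto simp: reflection_involution)

lemmas pair_group_induct [consumes 1, case_names id gen comp] = generate_involutions_induct
  [where S = "refl ` {\<beta>\<^sub>1, \<beta>\<^sub>2}", OF _ pair_involution, folded reflection_group_def]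

lemma base_in_\<Phi>: "\<beta>\<^sub>1 \<in> \<Phi> a b {\<beta>\<^sub>1, \<beta>\<^sub>2}" "\<beta>\<^sub>2 \<in> \<Phi> a b {\<beta>\<^sub>1, \<beta>\<^sub>2}"
proof -
  have "id \<in> reflection_group a b {\<beta>\<^sub>1, \<beta>\<^sub>2}"
    unfolding reflection_group_def one_BijGroup_UNIV[symmetric] by (rule generate.one)
  then have "id \<gamma> \<in> \<Phi> a b {\<beta>\<^sub>1, \<beta>\<^sub>2}" if "\<gamma> \<in> {\<beta>\<^sub>1, \<beta>\<^sub>2}" for \<gamma>
    using that unfolding \<Phi>_def by blast
  then show "\<beta>\<^sub>1 \<in> \<Phi> a b {\<beta>\<^sub>1, \<beta>\<^sub>2}" "\<beta>\<^sub>2 \<in> \<Phi> a b {\<beta>\<^sub>1, \<beta>\<^sub>2}" by auto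
qed

lemma \<Phi>_closed:
  assumes "\<beta> \<in> {\<beta>\<^sub>1, \<beta>\<^sub>2}" "\<gamma> \<in> \<Phi> a b {\<beta>\<^sub>1, \<beta>\<^sub>2}"
  shows "refl \<beta> \<gamma> \<in> \<Phi> a b {\<beta>\<^sub>1, \<beta>\<^sub>2}"
proof -
  obtain g \<delta> where g: "g \<in> reflection_group a b {\<beta>\<^sub>1, \<beta>\<^sub>2}" "\<delta> \<in> {\<beta>\<^sub>1, \<beta>\<^sub>2}" "\<gamma> = g \<delta>"
    using assms(2) unfolding \<Phi>_def by blast
  have "refl \<beta> \<in> reflection_group a b {\<beta>\<^sub>1, \<beta>\<^sub>2}"
    using assms(1) by (auto simp: reflection_group_def intro: generate.incl)
  then have "refl \<beta> \<circ> g \<in> reflection_group a b {\<beta>\<^sub>1, \<beta>\<^sub>2}"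
    using g generate_involutions_comp[OF pair_involution] by (simp add: reflection_group_def)
  moreover have "refl \<beta> \<gamma> = (refl \<beta> \<circ> g) \<delta>" using g by simp
  ultimately show ?thesis using g unfolding \<Phi>_def by blast
qed

lemma \<Phi>_minimal:
  assumes base: "\<beta>\<^sub>1 \<in> X" "\<beta>\<^sub>2 \<in> X"
    and closed: "\<And>x. x \<in> X \<Longrightarrow> refl \<beta>\<^sub>1 x \<in> X" "\<And>x. x \<in> X \<Longrightarrow> refl \<beta>\<^sub>2 x \<in> X"
  shows "\<Phi> a b {\<beta>\<^sub>1, \<beta>\<^sub>2} \<subseteq> X"
proof -
  have "g x \<in> X" if "g \<in> reflection_group a b {\<beta>\<^sub>1, \<beta>\<^sub>2}" "x \<in> X" for g x
    using that
  proof (induction arbitrary: x rule: pair_group_induct)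
    case (gen s)
    then show ?case using closed by blast
  qed simp_all
  then show ?thesis using base unfolding \<Phi>_def by blast
qed

lemma \<Phi>_subset_\<Delta>re: "\<Phi> a b {\<beta>\<^sub>1, \<beta>\<^sub>2} \<subseteq> \<Delta>re a b {\<beta>\<^sub>1, \<beta>\<^sub>2}"
proof -
  have "\<beta>\<^sub>1 = comb 1 0" "\<beta>\<^sub>2 = comb 0 1" by simp_all
  then have "\<Phi> a b {\<beta>\<^sub>1, \<beta>\<^sub>2} \<subseteq> {comb p q | p q. True}"
    by (intro \<Phi>_minimal) (use reflection_comb in blast)+
  moreover have "\<Phi> a b {\<beta>\<^sub>1, \<beta>\<^sub>2} \<subseteq> R"
    using real reflection_real_root by (intro \<Phi>_minimal) auto
  ultimately show ?thesis unfolding \<Delta>re_def int_span_pair by blast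
qed

text \<open>Descent: the norm of \<open>\<gamma> = p \<beta>\<^sub>1 + q \<beta>\<^sub>2\<close> is \<open>p (\<gamma>, \<beta>\<^sub>1) + q (\<gamma>, \<beta>\<^sub>2) > 0\<close>, so one of the two
  terms is positive, and reflecting in the corresponding \<open>\<beta>\<^sub>i\<close> shrinks that coefficient while
  keeping \<open>\<gamma>\<close> a real root in the lattice.  The descent can only end on one of the axes,
  where primitivity leaves nothing but \<open>\<plusminus> \<beta>\<^sub>1\<close> and \<open>\<plusminus> \<beta>\<^sub>2\<close>.\<close>

lemma comb_in_\<Phi>: "comb p q \<in> R \<Longrightarrow> comb p q \<in> \<Phi> a b {\<beta>\<^sub>1, \<beta>\<^sub>2}"
proof (induction "nat (\<bar>p\<bar> + \<bar>q\<bar>)" arbitrary: p q rule: less_induct)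
  case less
  have minus: "- \<beta>\<^sub>1 \<in> \<Phi> a b {\<beta>\<^sub>1, \<beta>\<^sub>2}" "- \<beta>\<^sub>2 \<in> \<Phi> a b {\<beta>\<^sub>1, \<beta>\<^sub>2}"
    using \<Phi>_closed base_in_\<Phi> reflection_self norm_pos by (metis insertCI less_irrefl)+
  consider "p = 0" | "q = 0" | "p * q > 0"
    using real_root_sign_coherent[OF less(2)] by (metis less_le mult_eq_0_iff)
  then show ?case
  proof cases
    case 1
    then have "q = 1 \<or> q = - 1" using real_root_multiple[OF less(2) real(2)] by simp
    then show ?thesis using 1 minus base_in_\<Phi> by auto
  next
    case 2
    then have "p = 1 \<or> p = - 1" using real_root_multiple[OF less(2) real(1)] by simp
    then show ?thesis using 2 minus base_in_\<Phi> by auto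
  next
    case 3
    \<comment> \<open>\<open>2 p - n q\<close> and \<open>2 q - m p\<close> are the Cartan integers of \<open>\<gamma>\<close> against \<open>\<beta>\<^sub>1\<close> and \<open>\<beta>\<^sub>2\<close>.\<close>
    have "2 * ip (comb p q) (comb p q) =
        of_int (2 * p\<^sup>2) * ip \<beta>\<^sub>1 \<beta>\<^sub>1 + of_int (2 * q\<^sup>2) * ip \<beta>\<^sub>2 \<beta>\<^sub>2
        + of_int (p * q) * (- of_int n * ip \<beta>\<^sub>1 \<beta>\<^sub>1) + of_int (p * q) * (- of_int m * ip \<beta>\<^sub>2 \<beta>\<^sub>2)"
      unfolding norm_comb cartan[symmetric] by simp
    also have "\<dots> =
        of_int (p * (2 * p - n * q)) * ip \<beta>\<^sub>1 \<beta>\<^sub>1 + of_int (q * (2 * q - m * p)) * ip \<beta>\<^sub>2 \<beta>\<^sub>2"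
      by (simp add: algebra_simps power2_eq_square)
    finally have "2 * ip (comb p q) (comb p q) =
        of_int (p * (2 * p - n * q)) * ip \<beta>\<^sub>1 \<beta>\<^sub>1 + of_int (q * (2 * q - m * p)) * ip \<beta>\<^sub>2 \<beta>\<^sub>2" .
    then have "0 < of_int (p * (2 * p - n * q)) * ip \<beta>\<^sub>1 \<beta>\<^sub>1
        + of_int (q * (2 * q - m * p)) * ip \<beta>\<^sub>2 \<beta>\<^sub>2"
      using real_root_norm(1)[OF less(2)] by linarith
    then have "0 < p * (2 * p - n * q) \<or> 0 < q * (2 * q - m * p)"
      using norm_pos by (smt (verit) mult_nonpos_nonneg of_int_0_less_iff)
    then show ?thesis
    proof
      assume *: "0 < p * (2 * p - n * q)"
      have "\<bar>n * q - p\<bar> < \<bar>p\<bar>"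
        using * 3 pos by (auto simp: zero_less_mult_iff abs_if) (smt (verit) mult_pos_pos mult_pos_neg)+
      then have "nat (\<bar>n * q - p\<bar> + \<bar>q\<bar>) < nat (\<bar>p\<bar> + \<bar>q\<bar>)" by linarith
      moreover have "comb (n * q - p) q \<in> R"
        using reflection_real_root[OF real(1) less(2)] reflection_comb by simp
      ultimately have "refl \<beta>\<^sub>1 (comb (n * q - p) q) \<in> \<Phi> a b {\<beta>\<^sub>1, \<beta>\<^sub>2}"
        using less(1) \<Phi>_closed by blast
      then show ?thesis unfolding reflection_comb by simp
    next
      assume *: "0 < q * (2 * q - m * p)"
      have "\<bar>m * p - q\<bar> < \<bar>q\<bar>"
        using * 3 pos by (auto simp: zero_less_mult_iff abs_if) (smt (verit) mult_pos_pos mult_pos_neg)+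
      then have "nat (\<bar>p\<bar> + \<bar>m * p - q\<bar>) < nat (\<bar>p\<bar> + \<bar>q\<bar>)" by linarith
      moreover have "comb p (m * p - q) \<in> R"
        using reflection_real_root[OF real(2) less(2)] reflection_comb by simp
      ultimately have "refl \<beta>\<^sub>2 (comb p (m * p - q)) \<in> \<Phi> a b {\<beta>\<^sub>1, \<beta>\<^sub>2}"
        using less(1) \<Phi>_closed by blast
      then show ?thesis unfolding reflection_comb by simp
    qed
  qed
qed

lemma \<Delta>re_eq_\<Phi>: "\<Delta>re a b {\<beta>\<^sub>1, \<beta>\<^sub>2} = \<Phi> a b {\<beta>\<^sub>1, \<beta>\<^sub>2}"
proof
  show "\<Delta>re a b {\<beta>\<^sub>1, \<beta>\<^sub>2} \<subseteq> \<Phi> a b {\<beta>\<^sub>1, \<beta>\<^sub>2}"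
    using comb_in_\<Phi> unfolding \<Delta>re_def int_span_pair by blast
qed (rule \<Phi>_subset_\<Delta>re)

text \<open>Parallel vectors have equality in the Cauchy--Schwarz inequality, which for the
  Cartan integers reads \<open>m n = 4\<close>.\<close>

lemma base_independent: "\<beta>\<^sub>1 \<noteq> \<beta>\<^sub>2" "independent {\<beta>\<^sub>1, \<beta>\<^sub>2}"
proof -
  have not_multiple: "\<beta>\<^sub>2 \<noteq> r *\<^sub>R \<beta>\<^sub>1" for r
  proof
    assume r: "\<beta>\<^sub>2 = r *\<^sub>R \<beta>\<^sub>1"
    have products: "2 * r * ip \<beta>\<^sub>1 \<beta>\<^sub>1 = - of_int n * ip \<beta>\<^sub>1 \<beta>\<^sub>1"
      "2 * r * ip \<beta>\<^sub>1 \<beta>\<^sub>1 = - of_int m * (r * r) * ip \<beta>\<^sub>1 \<beta>\<^sub>1"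
      using cartan unfolding r form_bilinear by (simp_all only: mult.assoc)
    have "ip \<beta>\<^sub>1 \<beta>\<^sub>1 \<noteq> 0" using norm_pos(1) by linarith
    note cancel = mult_right_cancel[OF this, THEN iffD1]
    have r_eqs: "2 * r = - of_int n" "2 * r = - of_int m * (r * r)"
      using products by (blast intro: cancel)+
    then have "(of_int m * r) * r = - 2 * r" "r \<noteq> 0" using pos(1) by auto
    then have "of_int m * r = - 2" using mult_right_cancel[of r "of_int m * r" "- 2"] by blast
    moreover have "of_int n = - 2 * r" using r_eqs(1) by simp
    ultimately have "of_int m * of_int n = (4 :: real)" by simp
    then have "real_of_int (m * n) = 4" by simp
    then show False using pos(3) by linarith
  qed
  from not_multiple[of 1] show "\<beta>\<^sub>1 \<noteq> \<beta>\<^sub>2" by auto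
  have "\<beta>\<^sub>1 \<noteq> 0" using norm_pos(1) by (auto simp: form_def)
  then have "independent {\<beta>\<^sub>2, \<beta>\<^sub>1}"
    using not_multiple by (auto simp: independent_insert span_singleton)
  then show "independent {\<beta>\<^sub>1, \<beta>\<^sub>2}" by (simp add: insert_commute)
qed

lemma \<Phi>_simple_basis: "simple_basis a b (\<Phi> a b {\<beta>\<^sub>1, \<beta>\<^sub>2}) \<beta>\<^sub>1 \<beta>\<^sub>2"
proof -
  have "\<exists>p q :: nat. \<gamma> = of_nat p *\<^sub>R \<beta>\<^sub>1 + of_nat q *\<^sub>R \<beta>\<^sub>2 \<or>
        \<gamma> = - (of_nat p *\<^sub>R \<beta>\<^sub>1 + of_nat q *\<^sub>R \<beta>\<^sub>2)" if \<gamma>_in: "\<gamma> \<in> \<Phi> a b {\<beta>\<^sub>1, \<beta>\<^sub>2}" for \<gamma>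
  proof -
    obtain p q where \<gamma>: "\<gamma> = comb p q" and "comb p q \<in> R"
      using \<gamma>_in \<Phi>_subset_\<Delta>re unfolding \<Delta>re_def int_span_pair by blast
    then have "p * q \<ge> 0" using real_root_sign_coherent by simp
    then consider "p \<ge> 0" "q \<ge> 0" | "p \<le> 0" "q \<le> 0" by (auto simp: zero_le_mult_iff)
    then show ?thesis
    proof cases
      case 1
      then show ?thesis by (intro exI[of _ "nat p"] exI[of _ "nat q"]) (simp add: \<gamma>)
    next
      case 2
      then show ?thesis by (intro exI[of _ "nat (- p)"] exI[of _ "nat (- q)"]) (simp add: \<gamma>)
    qed
  qed
  then show ?thesis using base_in_\<Phi> base_independent by (auto simp: simple_basis_def)
qed

lemma pair_cartan_matrix: "cartan_matrix a b \<beta>\<^sub>1 \<beta>\<^sub>2 = H m n"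
proof -
  have "2 * ip \<beta>\<^sub>1 \<beta>\<^sub>2 / ip \<beta>\<^sub>1 \<beta>\<^sub>1 = - of_int n" "2 * ip \<beta>\<^sub>2 \<beta>\<^sub>1 / ip \<beta>\<^sub>2 \<beta>\<^sub>2 = - of_int m"
    unfolding form_commute[of a b \<beta>\<^sub>2 \<beta>\<^sub>1] using norm_pos
    by (simp add: cartan(1), simp only: cartan(2), simp)
  then show ?thesis using norm_pos by (simp add: cartan_matrix_def H_def)
qed

lemma \<Phi>_of_type: "\<Phi>_subsystem_of_type a b (\<Phi> a b {\<beta>\<^sub>1, \<beta>\<^sub>2}) m n"
proof -
  have "{\<beta>\<^sub>1, \<beta>\<^sub>2} \<subseteq> R" using real by simp
  then show ?thesis
    using \<Phi>_simple_basis pair_cartan_matrix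
    unfolding \<Phi>_subsystem_of_type_def \<Phi>_subsystem_def by blast
qed

lemma exists_\<Phi>_subsystem: "\<exists>\<Psi> \<subseteq> roots a b. \<Phi>_subsystem_of_type a b \<Psi> m n"
proof (intro exI conjI)
  show "\<Phi> a b {\<beta>\<^sub>1, \<beta>\<^sub>2} \<subseteq> roots a b" using \<Phi>_subset_\<Delta>re unfolding \<Delta>re_def roots_def by blast
qed (rule \<Phi>_of_type)

lemma exists_\<Delta>_subsystem: "\<exists>D \<subseteq> roots a b. \<Delta>_subsystem_of_type a b D m n"
proof (intro exI conjI)
  show "\<Delta> a b {\<beta>\<^sub>1, \<beta>\<^sub>2} \<subseteq> roots a b" by (simp add: \<Delta>_def)
  show "\<Delta>_subsystem_of_type a b (\<Delta> a b {\<beta>\<^sub>1, \<beta>\<^sub>2}) m n"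
    unfolding \<Delta>_subsystem_of_type_def using real \<Phi>_of_type \<Delta>re_eq_\<Phi>
    by (intro exI[of _ "{\<beta>\<^sub>1, \<beta>\<^sub>2}"]) auto
qed

end

section \<open>Infinitely many types\<close>

lemma infinite_int_if_unbounded_step:
  fixes x :: int
  assumes "P x" and "\<And>x. P x \<Longrightarrow> \<exists>y > x. P y"
  shows "infinite {x. P x}"
proof
  assume fin: "finite {x. P x}"
  then have "P (Max {x. P x})" using Max_in[OF fin] assms(1) by blast
  then obtain y where "y > Max {x. P x}" "P y" using assms(2) by blast
  then show False using Max_ge[OF fin, of y] by simp
qed

context rank2_hyperbolic
begin

text \<open>The long roots that form a base of type \<open>H(k, k)\<close> together with \<open>\<alpha>\<^sub>1\<close>.\<close>

definition long_partner :: "int \<Rightarrow> vec \<Rightarrow> bool" where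
  "long_partner k \<gamma> \<longleftrightarrow> k \<ge> 3 \<and> \<gamma> \<in> R \<and> ip \<gamma> \<gamma> = long_norm \<and> 2 * ip \<alpha>\<^sub>1 \<gamma> = - of_int k * long_norm"

text \<open>The roots of norm \<open>2\<close> that form a base of type \<open>H(a l, b l)\<close> together with \<open>\<alpha>\<^sub>1\<close>: their Cartan
  integers against \<open>\<alpha>\<^sub>1\<close> are \<open>- a l\<close> and \<open>- b l\<close>, because \<open>(\<alpha>\<^sub>1, \<alpha>\<^sub>1) = 2 a / b\<close>.\<close>

definition short_partner :: "int \<Rightarrow> vec \<Rightarrow> bool" where
  "short_partner l \<gamma> \<longleftrightarrow> l \<ge> 2 \<and> \<gamma> \<in> R \<and> ip \<gamma> \<gamma> = 2 \<and> ip \<alpha>\<^sub>1 \<gamma> = - of_int (a * l)"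

lemma long_partner_pair: "long_partner k \<gamma> \<Longrightarrow> real_root_pair a b \<alpha>\<^sub>1 \<gamma> k k"
  using simple_roots_real mult_mono[of 3 k 3 k]
  by unfold_locales (auto simp: long_partner_def ip_simple)

lemma short_partner_pair:
  assumes "short_partner l \<gamma>"
  shows "real_root_pair a b \<alpha>\<^sub>1 \<gamma> (a * l) (b * l)"
proof unfold_locales
  have l: "l \<ge> 2" using assms by (simp add: short_partner_def)
  then show "b * l > 0" "a * l > 0" using b_ge_1 a_pos by simp_all
  have "4 * 1 < (a * b) * (l * l)"
    using ab_gt_4 l mult_mono[of 2 l 2 l] by (intro mult_less_le_imp_less) auto
  then show "a * l * (b * l) > 4" by (simp add: algebra_simps)
qed (use assms simple_roots_real b_ge_1 in \<open>auto simp: short_partner_def ip_simple\<close>)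

lemma long_partner_start: "long_partner (a * b - 2) (refl \<alpha>\<^sub>2 \<alpha>\<^sub>1)"
proof -
  have "ip (refl \<alpha>\<^sub>2 \<alpha>\<^sub>1) (refl \<alpha>\<^sub>2 \<alpha>\<^sub>1) = long_norm" by (simp add: form_reflection ip_simple)
  moreover have "2 * ip \<alpha>\<^sub>1 (refl \<alpha>\<^sub>2 \<alpha>\<^sub>1) = - of_int (a * b - 2) * long_norm"
    using b_ge_1 by (simp add: reflection_def form_bilinear ip_simple field_simps)
  ultimately show ?thesis
    using ab_gt_4 simple_roots_real reflection_real_root by (simp add: long_partner_def)
qed

text \<open>Here \<open>w\<^sub>\<gamma> \<alpha>\<^sub>1 = \<alpha>\<^sub>1 + k \<gamma>\<close>, whose Cartan integer against \<open>\<alpha>\<^sub>1\<close> is \<open>2 - k\<^sup>2\<close>.\<close>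

lemma long_partner_step:
  assumes "long_partner k \<gamma>"
  shows "long_partner (k\<^sup>2 - 2) (refl \<gamma> \<alpha>\<^sub>1)" and "k < k\<^sup>2 - 2"
proof -
  have \<gamma>: "k \<ge> 3" "\<gamma> \<in> R" "ip \<gamma> \<gamma> = long_norm" "2 * ip \<alpha>\<^sub>1 \<gamma> = - of_int k * long_norm"
    using assms by (auto simp: long_partner_def)
  have "long_norm \<noteq> 0" using long_ge_2 by linarith
  then have "2 * ip \<alpha>\<^sub>1 \<gamma> / ip \<gamma> \<gamma> = - of_int k"
    unfolding \<gamma> by (rule nonzero_mult_div_cancel_right)
  then have refl: "refl \<gamma> \<alpha>\<^sub>1 = \<alpha>\<^sub>1 + of_int k *\<^sub>R \<gamma>" unfolding reflection_def by simp
  have "2 * ip \<alpha>\<^sub>1 (refl \<gamma> \<alpha>\<^sub>1) = 2 * long_norm + of_int k * (2 * ip \<alpha>\<^sub>1 \<gamma>)"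
    unfolding refl by (simp add: form_bilinear ip_simple)
  then have pairing: "2 * ip \<alpha>\<^sub>1 (refl \<gamma> \<alpha>\<^sub>1) = - of_int (k\<^sup>2 - 2) * long_norm"
    unfolding \<gamma> by (simp add: algebra_simps power2_eq_square diff_divide_distrib)
  have norm: "ip (refl \<gamma> \<alpha>\<^sub>1) (refl \<gamma> \<alpha>\<^sub>1) = long_norm"
    by (simp add: weyl_isometry[OF real_root_reflection_in_weyl[OF \<gamma>(2)]] ip_simple)
  have "k * 3 \<le> k\<^sup>2" using \<gamma>(1) by (simp add: power2_eq_square)
  then show "k < k\<^sup>2 - 2" using \<gamma>(1) by linarith
  then show "long_partner (k\<^sup>2 - 2) (refl \<gamma> \<alpha>\<^sub>1)"
    using \<gamma> norm pairing simple_roots_real reflection_real_root by (simp add: long_partner_def)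
qed

text \<open>The next short root is \<open>w\<^sub>\<gamma> w\<^sub>1 \<gamma> = b l \<alpha>\<^sub>1 + (a b l\<^sup>2 - 1) \<gamma>\<close>.  The bound \<open>l \<ge> 1\<close> is what lets
  \<open>\<alpha>\<^sub>2\<close> itself, with \<open>l = 1\<close>, start the sequence.\<close>

lemma short_partner_next:
  assumes "l \<ge> 1" "\<gamma> \<in> R" "ip \<gamma> \<gamma> = 2" "ip \<alpha>\<^sub>1 \<gamma> = - of_int (a * l)"
  shows "short_partner (l * (a * b * l\<^sup>2 - 3)) (refl \<gamma> (refl \<alpha>\<^sub>1 \<gamma>))"
    and "l < l * (a * b * l\<^sup>2 - 3)"
proof -
  let ?\<gamma>' = "refl \<gamma> (refl \<alpha>\<^sub>1 \<gamma>)"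
  have "refl \<alpha>\<^sub>1 \<gamma> = \<gamma> + of_int (b * l) *\<^sub>R \<alpha>\<^sub>1"
    using assms b_ge_1 a_pos by (simp add: reflection_def form_commute[of a b \<gamma> \<alpha>\<^sub>1] ip_simple)
  moreover have "refl \<gamma> \<alpha>\<^sub>1 = \<alpha>\<^sub>1 + of_int (a * l) *\<^sub>R \<gamma>"
    using assms by (simp add: reflection_def)
  ultimately have next_root: "?\<gamma>' = - \<gamma> + of_int (b * l) *\<^sub>R (\<alpha>\<^sub>1 + of_int (a * l) *\<^sub>R \<gamma>)"
    using assms linear_reflection[of a b \<gamma>] reflection_self[of a b \<gamma>]
    by (simp add: linear_add linear_scale)
  have "ip \<alpha>\<^sub>1 ?\<gamma>' = - ip \<alpha>\<^sub>1 \<gamma> + of_int (2 * a * l) + of_int (b * l * a * l) * ip \<alpha>\<^sub>1 \<gamma>"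
    unfolding next_root form_bilinear ip_simple(1) using b_ge_1 by (simp add: algebra_simps)
  then have pairing: "ip \<alpha>\<^sub>1 ?\<gamma>' = - of_int (a * (l * (a * b * l\<^sup>2 - 3)))"
    unfolding assms(4) by (simp add: algebra_simps power2_eq_square)
  have norm: "ip ?\<gamma>' ?\<gamma>' = 2"
    using assms simple_roots_real by (simp add: weyl_isometry real_root_reflection_in_weyl)
  have "5 * 1 \<le> (a * b) * l\<^sup>2" using assms(1) ab_gt_4 by (intro mult_mono) auto
  then have "l * 2 \<le> l * (a * b * l\<^sup>2 - 3)" using assms(1) by (intro mult_left_mono) auto
  then show "l < l * (a * b * l\<^sup>2 - 3)" using assms(1) by linarith
  then have "2 \<le> l * (a * b * l\<^sup>2 - 3)" using assms(1) by linarith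
  moreover have "?\<gamma>' \<in> R" using assms(2) simple_roots_real reflection_real_root by blast
  ultimately show "short_partner (l * (a * b * l\<^sup>2 - 3)) ?\<gamma>'"
    unfolding short_partner_def using pairing norm by blast
qed

lemma infinite_long_partners: "infinite {k. \<exists>\<gamma>. long_partner k \<gamma>}"
  using long_partner_start long_partner_step
  by (intro infinite_int_if_unbounded_step[of _ "a * b - 2"]) blast+

lemma infinite_short_partners: "infinite {l. \<exists>\<gamma>. short_partner l \<gamma>}"
proof (rule infinite_int_if_unbounded_step)
  show "\<exists>\<gamma>. short_partner (1 * (a * b * 1\<^sup>2 - 3)) \<gamma>"
    by (rule exI, rule short_partner_next(1)[of 1 \<alpha>\<^sub>2]) (simp_all add: simple_roots_real ip_simple)
  show "\<exists>l' > l. \<exists>\<gamma>. short_partner l' \<gamma>" if "\<exists>\<gamma>. short_partner l \<gamma>" for l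
  proof -
    from that obtain \<gamma> where "l \<ge> 1" "\<gamma> \<in> R" "ip \<gamma> \<gamma> = 2" "ip \<alpha>\<^sub>1 \<gamma> = - of_int (a * l)"
      by (auto simp: short_partner_def)
    from short_partner_next[OF this] show ?thesis by blast
  qed
qed

end

theorem theorem1p3:
  fixes a b :: int
  assumes "b \<ge> 1" and "a \<ge> b" and "a * b > 4"
  shows "infinite {k :: int. k \<ge> 3 \<and> (\<exists>\<Psi> \<subseteq> roots a b. \<Phi>_subsystem_of_type a b \<Psi> k k)} \<and>
         infinite {k :: int. k \<ge> 3 \<and> (\<exists>D \<subseteq> roots a b. \<Delta>_subsystem_of_type a b D k k)} \<and>
         (a \<noteq> b \<longrightarrow>
            infinite {l :: int. l \<ge> 2 \<and> (\<exists>\<Psi> \<subseteq> roots a b. \<Phi>_subsystem_of_type a b \<Psi> (a * l) (b * l))} \<and>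
            infinite {l :: int. l \<ge> 2 \<and> (\<exists>D \<subseteq> roots a b. \<Delta>_subsystem_of_type a b D (a * l) (b * l))})"
proof -
  interpret rank2_hyperbolic a b using assms by unfold_locales
  have long_\<Phi>: "k \<ge> 3 \<and> (\<exists>\<Psi> \<subseteq> roots a b. \<Phi>_subsystem_of_type a b \<Psi> k k)"
    and long_\<Delta>: "k \<ge> 3 \<and> (\<exists>D \<subseteq> roots a b. \<Delta>_subsystem_of_type a b D k k)"
    if "\<exists>\<gamma>. long_partner k \<gamma>" for k
  proof -
    from that obtain \<gamma> where \<gamma>: "long_partner k \<gamma>" by (rule exE)
    then have bound: "k \<ge> 3" by (simp add: long_partner_def)
    show "k \<ge> 3 \<and> (\<exists>\<Psi> \<subseteq> roots a b. \<Phi>_subsystem_of_type a b \<Psi> k k)"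
      using bound real_root_pair.exists_\<Phi>_subsystem[OF long_partner_pair[OF \<gamma>]] by (rule conjI)
    show "k \<ge> 3 \<and> (\<exists>D \<subseteq> roots a b. \<Delta>_subsystem_of_type a b D k k)"
      using bound real_root_pair.exists_\<Delta>_subsystem[OF long_partner_pair[OF \<gamma>]] by (rule conjI)
  qed
  have short_\<Phi>: "l \<ge> 2 \<and> (\<exists>\<Psi> \<subseteq> roots a b. \<Phi>_subsystem_of_type a b \<Psi> (a * l) (b * l))"
    and short_\<Delta>: "l \<ge> 2 \<and> (\<exists>D \<subseteq> roots a b. \<Delta>_subsystem_of_type a b D (a * l) (b * l))"
    if "\<exists>\<gamma>. short_partner l \<gamma>" for l
  proof -
    from that obtain \<gamma> where \<gamma>: "short_partner l \<gamma>" by (rule exE)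
    then have bound: "l \<ge> 2" by (simp add: short_partner_def)
    show "l \<ge> 2 \<and> (\<exists>\<Psi> \<subseteq> roots a b. \<Phi>_subsystem_of_type a b \<Psi> (a * l) (b * l))"
      using bound real_root_pair.exists_\<Phi>_subsystem[OF short_partner_pair[OF \<gamma>]] by (rule conjI)
    show "l \<ge> 2 \<and> (\<exists>D \<subseteq> roots a b. \<Delta>_subsystem_of_type a b D (a * l) (b * l))"
      using bound real_root_pair.exists_\<Delta>_subsystem[OF short_partner_pair[OF \<gamma>]] by (rule conjI)
  qed
  note long_types = infinite_super[OF Collect_mono[OF impI] infinite_long_partners]
  note short_types = infinite_super[OF Collect_mono[OF impI] infinite_short_partners]
  show ?thesis
    using long_types[OF long_\<Phi>] long_types[OF long_\<Delta>]
      short_types[OF short_\<Phi>] short_types[OF short_\<Delta>]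
    by (intro conjI impI)
qed

end
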